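(* Let $n \ge 1$ and let $X$ be a matrix in the elliptope $\mathcal{L}_n$. Then $X$ is a fixed point of $T$ (i.e. $X \in T(X)$) if and only if there exists a diagonal matrix $D \in \mathbb{R}^{n\times n}$ such that $X^2 = DX$.
   Context: Let $\mathcal{S}(n)$ be the space of real symmetric $n\times n$ matrices with inner product $X\cdot Y = \sum_{i,j} X_{i,j}Y_{i,j}$. The elliptope is $\mathcal{L}_n = \{ X \in \mathcal{S}(n) : X \succeq 0,\ X_{i,i} = 1 \text{ for all } i\}$. For $M \in \mathcal{S}(n)$, $T(M) = \operatorname{argmax}_{Y \in \mathcal{L}_n} M\cdot Y$ denotes the set of all maximizers. A fixed point of $T$ is a matrix $X \in \mathcal{L}_n$ with $X \in T(X)$, i.e. $X\cdot X \ge X \cdot Y$ for all $Y \in \mathcal{L}_n$. *)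

theory Defs
  imports "HOL-Analysis.Analysis"
begin

(* The trace inner product X . Y = sum_ij X_ij Y_ij is the library inner product
   on the Euclidean space real^'n^'n; see the lemma inner_matrix_eq_sum below. *)

definition symmetric_matrix :: "real^'n^'n \<Rightarrow> bool" where
  "symmetric_matrix A \<longleftrightarrow> transpose A = A"

definition pos_semidef :: "real^'n^'n \<Rightarrow> bool" where
  "pos_semidef A \<longleftrightarrow> symmetric_matrix A \<and> (\<forall>v. 0 \<le> v \<bullet> (A *v v))"

definition diagonal_matrix :: "real^'n^'n \<Rightarrow> bool" where
  "diagonal_matrix D \<longleftrightarrow> (\<forall>i j. i \<noteq> j \<longrightarrow> D $ i $ j = 0)"

definition elliptope :: "(real^'n^'n) set" where
  "elliptope = {X. pos_semidef X \<and> (\<forall>i. X $ i $ i = 1)}"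

(* T M is the set of all maximizers. The map is meant for symmetric M only. *)
definition T :: "real^'n^'n \<Rightarrow> (real^'n^'n) set" where
  "T M = {X. is_arg_max (\<lambda>Y. M \<bullet> Y) (\<lambda>Y. Y \<in> elliptope) X}"

lemma inner_matrix_eq_sum:
  fixes X Y :: "real^'n^'n"
  shows "X \<bullet> Y = (\<Sum>i\<in>UNIV. \<Sum>j\<in>UNIV. X $ i $ j * Y $ i $ j)"
  by (simp add: inner_vec_def)

lemma mem_T_iff: "X \<in> T M \<longleftrightarrow> X \<in> elliptope \<and> (\<forall>Y\<in>elliptope. M \<bullet> Y \<le> M \<bullet> X)"
  by (auto simp: T_def is_arg_max_linorder)

end

theory Submission
  imports Defs
begin

text \<open>Throughout, write \<open>e\<^sub>i\<close> for the standard basis and \<open>d\<^sub>i\<close> for the \<open>i\<close>-th diagonal entry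
  of \<open>D\<close>.

  If \<open>X\<^sup>2 = D X\<close>, comparing diagonals gives \<open>d\<^sub>i = \<Sum>\<^sub>j X\<^sub>i\<^sub>j\<^sup>2 \<ge> 1\<close>, so that \<open>tr D = X \<bullet> X\<close>, and
  symmetry of \<open>X\<^sup>2\<close> makes \<open>D\<close> commute with \<open>X\<close>. Hence
  \<open>D - X = (D - X) D\<^sup>-\<^sup>1 (D - X)\<close>, which exhibits \<open>D - X\<close> as a positive semidefinite matrix, a dual
  certificate of optimality: \<open>0 \<le> (D - X) \<bullet> Y = tr D - X \<bullet> Y = X \<bullet> X - X \<bullet> Y\<close> for every \<open>Y\<close> in the
  elliptope. The factorization splits \<open>D - X\<close> into rank-one terms, so nonnegativity of the pairing
  with \<open>Y\<close> can be read off without any spectral decomposition.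

  For the converse, no duality is needed. Think of \<open>X\<close> as the Gram matrix of unit
  vectors and let one of them, the \<open>a\<close>-th, move on the unit sphere. The entries of the Gram matrix
  that change are those in row and column \<open>a\<close>, and they are linear in the moving vector, so
  optimality says that the \<open>a\<close>-th vector maximizes a linear functional on the unit sphere. The
  equality case of the Cauchy-Schwarz inequality then makes it parallel to the vector representing
  that functional, and this parallelism is exactly row \<open>a\<close> of the equation \<open>X\<^sup>2 = D X\<close>. The Gram
  vectors are the basis vectors \<open>e\<^sub>i\<close> themselves, measured with the semi-inner product
  \<open>u \<bullet> (X *v v)\<close>.\<close>

section \<open>Symmetric and positive semidefinite forms\<close>

lemma symmetric_matrix_entry:
  assumes "symmetric_matrix (A::real^'n^'n)"
  shows "A $ i $ j = A $ j $ i"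
proof -
  have "transpose A $ i $ j = A $ j $ i" by (simp add: transpose_def)
  then show ?thesis using assms by (simp add: symmetric_matrix_def)
qed

lemma symmetric_matrix_inner_commute:
  assumes "symmetric_matrix (A::real^'n^'n)"
  shows "u \<bullet> (A *v v) = v \<bullet> (A *v u)"
proof -
  have "u \<bullet> (A *v v) = v \<bullet> (transpose A *v u)"
    unfolding transpose_matrix_vector by (metis dot_lmul_matrix inner_commute)
  then show ?thesis using assms by (simp only: symmetric_matrix_def)
qed

lemma symmetric_matrix_mult_axis:
  assumes "symmetric_matrix (A::real^'n^'n)"
  shows "A *v axis i 1 = A $ i"
  by (simp add: matrix_vector_mult_basis column_def vec_eq_iff symmetric_matrix_entry[OF assms])

lemma elliptope_symmetric: "X \<in> elliptope \<Longrightarrow> symmetric_matrix X"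
  by (simp add: elliptope_def pos_semidef_def)

lemma quadratic_form_diff:
  assumes "symmetric_matrix (A::real^'n^'n)"
  shows "(u - c *\<^sub>R v) \<bullet> (A *v (u - c *\<^sub>R v))
    = u \<bullet> (A *v u) - 2 * c * (u \<bullet> (A *v v)) + c\<^sup>2 * (v \<bullet> (A *v v))"
  using symmetric_matrix_inner_commute[OF assms, of v u]
  by (simp add: matrix_vector_mult_diff_distrib inner_diff_left inner_diff_right
      matrix_vector_mult_scaleR power2_eq_square algebra_simps)

text \<open>An isotropic vector minimizes the quadratic form, so the gradient of the form vanishes there.
  The proof makes a small step against that gradient.\<close>

lemma pos_semidef_isotropic_imp_kernel:
  assumes psd: "pos_semidef (A::real^'n^'n)" and iso: "v \<bullet> (A *v v) = 0"
  shows "A *v v = 0"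
proof (rule ccontr)
  define w where "w = A *v v"
  define s where "s = w \<bullet> w"
  define q where "q = w \<bullet> (A *v w)"
  assume "A *v v \<noteq> 0"
  then have s: "s > 0" by (simp add: s_def w_def)
  have q: "q \<ge> 0" using psd by (simp add: pos_semidef_def q_def)
  have sym: "symmetric_matrix A" using psd by (simp add: pos_semidef_def)
  define t where "t = s / (q + 1)"
  have t: "t > 0" using s q by (simp add: t_def)
  have "v \<bullet> (A *v w) = s"
    using symmetric_matrix_inner_commute[OF sym, of v w] by (simp add: s_def w_def)
  then have "(v - t *\<^sub>R w) \<bullet> (A *v (v - t *\<^sub>R w)) = t * (t * q - 2 * s)"
    unfolding quadratic_form_diff[OF sym] iso q_def[symmetric]
    by (simp add: power2_eq_square algebra_simps)
  moreover have "0 \<le> (v - t *\<^sub>R w) \<bullet> (A *v (v - t *\<^sub>R w))"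
    using psd by (simp add: pos_semidef_def)
  ultimately have "2 * s \<le> t * q" using t by (simp add: zero_le_mult_iff)
  moreover have "t * q \<le> s" using s q by (simp add: t_def field_simps)
  ultimately show False using s by simp
qed

section \<open>Moving one Gram vector\<close>

text \<open>This is the source of all competitors of \<open>X\<close> below. The family \<open>p\<close> plays the role of unit
  vectors with respect to the semi-inner product given by \<open>X\<close>.\<close>

lemma gram_matrix_in_elliptope:
  fixes p :: "'n \<Rightarrow> real^'n"
  assumes psd: "pos_semidef X" and unit: "\<And>i. p i \<bullet> (X *v p i) = 1"
  shows "(\<chi> i j. p i \<bullet> (X *v p j)) \<in> elliptope"
proof -
  let ?Y = "\<chi> i j. p i \<bullet> (X *v p j)"
  have sym: "symmetric_matrix X" using psd by (simp add: pos_semidef_def)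
  have "transpose ?Y = ?Y"
    by (simp add: transpose_def vec_eq_iff symmetric_matrix_inner_commute[OF sym])
  moreover have "0 \<le> v \<bullet> (?Y *v v)" for v
  proof -
    define w where "w = (\<Sum>j\<in>UNIV. v $ j *\<^sub>R p j)"
    have Xw: "X *v w = (\<Sum>j\<in>UNIV. v $ j *\<^sub>R (X *v p j))"
      unfolding w_def
      by (simp add: linear_sum[OF matrix_vector_mul_linear] matrix_vector_mult_scaleR)
    have "v \<bullet> (?Y *v v) = (\<Sum>i\<in>UNIV. v $ i * (p i \<bullet> (X *v w)))"
      unfolding Xw
      by (simp add: inner_vec_def[of v] matrix_vector_mult_def[of ?Y] inner_sum_right mult.commute)
    also have "\<dots> = w \<bullet> (X *v w)"
      by (simp add: w_def inner_sum_left)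
    finally show ?thesis using psd by (simp add: pos_semidef_def)
  qed
  ultimately show ?thesis
    by (simp add: elliptope_def pos_semidef_def symmetric_matrix_def unit)
qed

text \<open>Off the cross formed by row and column \<open>a\<close> nothing contributes, and the two arms contribute
  equally. They overlap only in the entry \<open>E $ a $ a\<close>, which is zero.\<close>

lemma inner_cross_supported:
  fixes X E :: "real^'n^'n"
  assumes symX: "symmetric_matrix X" and symE: "symmetric_matrix E"
    and diag: "E $ a $ a = 0" and supp: "\<And>i j. i \<noteq> a \<Longrightarrow> j \<noteq> a \<Longrightarrow> E $ i $ j = 0"
  shows "X \<bullet> E = 2 * (X $ a \<bullet> E $ a)"
proof -
  have row: "X $ i \<bullet> E $ i = X $ a $ i * E $ a $ i" if "i \<noteq> a" for i
  proof -
    have "X $ i \<bullet> E $ i = (\<Sum>j\<in>UNIV. if j = a then X $ i $ a * E $ i $ a else 0)"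
      unfolding inner_vec_def by (rule sum.cong) (use supp that in auto)
    then show ?thesis
      using symmetric_matrix_entry[OF symX, of i a] symmetric_matrix_entry[OF symE, of i a] by simp
  qed
  have "X \<bullet> E = X $ a \<bullet> E $ a + (\<Sum>i\<in>UNIV - {a}. X $ i \<bullet> E $ i)"
    unfolding inner_vec_def[of X] by (rule sum.remove) auto
  also have "(\<Sum>i\<in>UNIV - {a}. X $ i \<bullet> E $ i) = (\<Sum>i\<in>UNIV - {a}. X $ a $ i * E $ a $ i)"
    by (rule sum.cong) (use row in auto)
  also have "\<dots> = X $ a \<bullet> E $ a"
    unfolding inner_vec_def using diag by (subst (2) sum.remove[of _ a]) auto
  finally show ?thesis by simp
qed

text \<open>Moving only the \<open>a\<close>-th Gram vector from \<open>e\<^sub>a\<close> to \<open>p\<close> changes \<open>X \<bullet> Y\<close> by twice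
  \<open>(p - e\<^sub>a) \<bullet> (X *v g)\<close>. Subtracting \<open>axis a 1\<close> from the row deletes its diagonal
  entry, since the entry \<open>Y $ a $ a\<close> stays equal to 1.\<close>

lemma fixed_point_maximizes_linear_functional:
  fixes X :: "real^'n^'n" and a :: 'n
  assumes X: "X \<in> T X" and p: "p \<bullet> (X *v p) = 1"
  defines "g \<equiv> X $ a - axis a 1"
  shows "p \<bullet> (X *v g) \<le> axis a 1 \<bullet> (X *v g)"
proof -
  have el: "X \<in> elliptope" and max: "\<And>Y. Y \<in> elliptope \<Longrightarrow> X \<bullet> Y \<le> X \<bullet> X"
    using X by (auto simp: mem_T_iff)
  have psd: "pos_semidef X" and one: "\<And>i. X $ i $ i = 1"
    using el by (auto simp: elliptope_def)
  note sym = elliptope_symmetric[OF el]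
  define P where "P i = (if i = a then p else axis i 1)" for i
  define Y where "Y = (\<chi> i j. P i \<bullet> (X *v P j))"
  define E where "E = Y - X"
  have Y: "Y \<in> elliptope"
    unfolding Y_def
    by (rule gram_matrix_in_elliptope[OF psd])
      (simp add: P_def p symmetric_matrix_mult_axis[OF sym] inner_axis' one)
  have symE: "symmetric_matrix E"
    using symmetric_matrix_entry[OF sym] symmetric_matrix_entry[OF elliptope_symmetric[OF Y]]
    by (simp add: E_def symmetric_matrix_def transpose_def vec_eq_iff)
  have Eaa: "E $ a $ a = 0"
    using Y one by (simp add: E_def elliptope_def)
  have "X \<bullet> E = 2 * (X $ a \<bullet> E $ a)"
  proof (rule inner_cross_supported[OF sym symE Eaa])
    fix i j assume "i \<noteq> a" "j \<noteq> a"
    then show "E $ i $ j = 0"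
      using symmetric_matrix_entry[OF sym, of i j]
      by (simp add: E_def Y_def P_def symmetric_matrix_mult_axis[OF sym] inner_axis')
  qed
  moreover have "X \<bullet> E \<le> 0"
    using max[OF Y] by (simp add: E_def inner_diff_right)
  ultimately have "X $ a \<bullet> E $ a \<le> 0" by simp
  also have "X $ a \<bullet> E $ a = g \<bullet> (X *v p - X *v axis a 1)"
    unfolding inner_vec_def
  proof (rule sum.cong)
    fix j
    show "X $ a $ j \<bullet> E $ a $ j = g $ j \<bullet> (X *v p - X *v axis a 1) $ j"
    proof (cases "j = a")
      case True
      then show ?thesis by (simp add: Eaa g_def one)
    next
      case False
      have "p \<bullet> (X *v axis j 1) = (X *v p) $ j"
        using symmetric_matrix_inner_commute[OF sym, of p "axis j 1"] by (simp add: inner_axis')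
      moreover have "g $ j = X $ a $ j" using False by (simp add: g_def axis_def)
      ultimately show ?thesis
        using False by (simp add: E_def Y_def P_def symmetric_matrix_mult_axis[OF sym])
    qed
  qed simp
  finally show ?thesis
    using symmetric_matrix_inner_commute[OF sym, of p g]
      symmetric_matrix_inner_commute[OF sym, of "axis a 1" g]
    by (simp add: inner_diff_right)
qed

text \<open>The vector \<open>e\<^sub>a\<close> attains the maximum of the functional \<open>p \<mapsto> p \<bullet> (X *v g)\<close> on the
  unit sphere of the semi-inner product. Comparing with the normalized \<open>g\<close> gives the reverse
  Cauchy-Schwarz inequality, so \<open>g\<close> and \<open>e\<^sub>a\<close> are parallel modulo the kernel of \<open>X\<close>.\<close>

lemma fixed_point_row_eigenvector:
  fixes X :: "real^'n^'n"
  assumes X: "X \<in> T X"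
  shows "\<exists>c. X *v (X $ a) = c *\<^sub>R X $ a"
proof -
  define e :: "real^'n" where "e = axis a 1"
  define g where "g = X $ a - e"
  define m where "m = g \<bullet> (X *v g)"
  define l where "l = g \<bullet> (X *v e)"
  have el: "X \<in> elliptope" using X by (simp add: mem_T_iff)
  then have psd: "pos_semidef X" and one: "\<And>i. X $ i $ i = 1"
    by (auto simp: elliptope_def)
  note sym = elliptope_symmetric[OF el]
  have Xe: "X *v e = X $ a" by (simp add: e_def symmetric_matrix_mult_axis[OF sym])
  have m0: "m \<ge> 0" using psd by (simp add: m_def pos_semidef_def)
  have "m \<le> l\<^sup>2"
  proof (cases "m = 0")
    case False
    define p where "p = (1 / sqrt m) *\<^sub>R g"
    have "p \<bullet> (X *v p) = 1"
      using m0 False by (simp add: p_def matrix_vector_mult_scaleR m_def[symmetric])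
    from fixed_point_maximizes_linear_functional[OF X this, of a]
    have "p \<bullet> (X *v g) \<le> l"
      using symmetric_matrix_inner_commute[OF sym, of e g] by (simp add: l_def e_def g_def)
    moreover have "p \<bullet> (X *v g) = sqrt m"
      using m0 by (simp add: p_def m_def[symmetric] real_div_sqrt)
    ultimately show ?thesis using m0 by (simp add: sqrt_le_D)
  qed simp
  moreover have "(g - l *\<^sub>R e) \<bullet> (X *v (g - l *\<^sub>R e)) = m - l\<^sup>2"
  proof -
    have "e \<bullet> (X *v e) = 1" unfolding Xe by (simp add: e_def inner_axis' one)
    then show ?thesis
      unfolding quadratic_form_diff[OF sym] m_def[symmetric] l_def[symmetric]
      by (simp add: power2_eq_square)
  qed
  moreover have "0 \<le> (g - l *\<^sub>R e) \<bullet> (X *v (g - l *\<^sub>R e))"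
    using psd by (simp add: pos_semidef_def)
  ultimately have "X *v (g - l *\<^sub>R e) = 0"
    by (intro pos_semidef_isotropic_imp_kernel[OF psd]) simp
  then have "X *v (X $ a) = (l + 1) *\<^sub>R X $ a"
    by (simp add: g_def matrix_vector_mult_diff_distrib matrix_vector_mult_scaleR Xe algebra_simps)
  then show ?thesis ..
qed

section \<open>The dual certificate\<close>

lemma diagonal_matrix_mult_entry:
  assumes "diagonal_matrix D"
  shows "(D ** X) $ i $ j = D $ i $ i * X $ i $ j"
proof -
  have "(D ** X) $ i $ j = (\<Sum>k\<in>UNIV. if k = i then D $ i $ i * X $ i $ j else 0)"
    unfolding matrix_matrix_mult_def vec_lambda_beta
    by (rule sum.cong) (use assms in \<open>auto simp: diagonal_matrix_def\<close>)
  then show ?thesis by simp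
qed

text \<open>The vectors \<open>w i\<close> below are the rows of \<open>D - X\<close>; the nonnegative sum
  \<open>\<Sum>\<^sub>i (w i \<bullet> (Y *v w i)) / d i\<close> is the pairing of \<open>(D - X) D\<^sup>-\<^sup>1 (D - X) = D - X\<close> with \<open>Y\<close>.\<close>

lemma diagonal_equation_imp_optimal:
  fixes X Y :: "real^'n^'n"
  assumes X: "X \<in> elliptope" and Y: "Y \<in> elliptope"
    and D: "diagonal_matrix D" and eq: "X ** X = D ** X"
  shows "X \<bullet> Y \<le> X \<bullet> X"
proof -
  note symX = elliptope_symmetric[OF X] and symY = elliptope_symmetric[OF Y]
  note Xcomm = symmetric_matrix_entry[OF symX]
  have oneX: "\<And>i. X $ i $ i = 1" and oneY: "\<And>i. Y $ i $ i = 1"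
    using X Y by (auto simp: elliptope_def)
  define d where "d i = D $ i $ i" for i
  have sq: "(\<Sum>k\<in>UNIV. X $ i $ k * X $ k $ j) = d i * X $ i $ j" for i j
    using arg_cong[OF eq, of "\<lambda>M. M $ i $ j"]
    by (simp add: diagonal_matrix_mult_entry[OF D] d_def) (simp add: matrix_matrix_mult_def)
  have d_row: "d i = X $ i \<bullet> X $ i" for i
  proof -
    have "(\<Sum>k\<in>UNIV. X $ i $ k * X $ k $ i) = X $ i \<bullet> X $ i"
      unfolding inner_vec_def inner_real_def by (rule sum.cong) (metis Xcomm)+
    then show ?thesis using sq[of i i] by (simp add: oneX)
  qed
  have dpos: "d i > 0" for i
  proof -
    have "X $ i \<noteq> 0" using oneX[of i] by auto
    then show ?thesis by (simp add: d_row)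
  qed
  \<comment> \<open>\<open>D\<close> and \<open>X\<close> commute because \<open>X\<^sup>2\<close> is symmetric.\<close>
  have comm: "d i * X $ i $ j = d j * X $ i $ j" for i j
  proof -
    have "d i * X $ i $ j = (\<Sum>k\<in>UNIV. X $ i $ k * X $ k $ j)" by (simp add: sq)
    also have "\<dots> = (\<Sum>k\<in>UNIV. X $ j $ k * X $ k $ i)"
      by (rule sum.cong) (metis Xcomm mult.commute)+
    also have "\<dots> = d j * X $ i $ j" using Xcomm[of i j] by (simp add: sq)
    finally show ?thesis .
  qed
  have XDX: "(\<Sum>i\<in>UNIV. X $ i $ j * X $ i $ k / d i) = X $ j $ k" for j k
  proof -
    have "(\<Sum>i\<in>UNIV. X $ i $ j * X $ i $ k / d i) = (\<Sum>i\<in>UNIV. X $ j $ i * X $ i $ k) / d j"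
      unfolding sum_divide_distrib
    proof (rule sum.cong)
      fix i
      have "X $ i $ j / d i = X $ j $ i / d j"
        using comm[of i j] dpos[of i] dpos[of j] Xcomm[of i j] by (simp add: field_simps)
      then show "X $ i $ j * X $ i $ k / d i = X $ j $ i * X $ i $ k / d j"
        by (metis times_divide_eq_left)
    qed simp
    then show ?thesis using dpos[of j] by (simp add: sq)
  qed
  define w where "w i = X $ i - d i *\<^sub>R axis i 1" for i
  have w: "w i \<bullet> (Y *v w i) / d i
      = X $ i \<bullet> (Y *v X $ i) / d i - 2 * (X $ i \<bullet> Y $ i) + d i" for i
    unfolding w_def quadratic_form_diff[OF symY] symmetric_matrix_mult_axis[OF symY]
    using dpos[of i] by (simp add: inner_axis' oneY field_simps power2_eq_square)
  have quad: "(\<Sum>i\<in>UNIV. X $ i \<bullet> (Y *v X $ i) / d i) = X \<bullet> Y"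
  proof -
    have "(\<Sum>i\<in>UNIV. X $ i \<bullet> (Y *v X $ i) / d i)
        = (\<Sum>i\<in>UNIV. \<Sum>j\<in>UNIV. \<Sum>k\<in>UNIV. X $ i $ j * X $ i $ k / d i * Y $ j $ k)"
      by (simp add: inner_vec_def matrix_vector_mult_def sum_distrib_left sum_divide_distrib
          mult_ac)
    also have "\<dots> = (\<Sum>j\<in>UNIV. \<Sum>i\<in>UNIV. \<Sum>k\<in>UNIV. X $ i $ j * X $ i $ k / d i * Y $ j $ k)"
      by (rule sum.swap)
    also have "\<dots> = (\<Sum>j\<in>UNIV. \<Sum>k\<in>UNIV. \<Sum>i\<in>UNIV. X $ i $ j * X $ i $ k / d i * Y $ j $ k)"
      by (intro sum.cong refl sum.swap)
    also have "\<dots> = X \<bullet> Y"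
      unfolding sum_distrib_right[symmetric] XDX inner_matrix_eq_sum ..
    finally show ?thesis .
  qed
  have "0 \<le> (\<Sum>i\<in>UNIV. w i \<bullet> (Y *v w i) / d i)"
    using Y dpos by (intro sum_nonneg divide_nonneg_pos) (auto simp: elliptope_def pos_semidef_def)
  also have "\<dots> = X \<bullet> Y - 2 * (X \<bullet> Y) + X \<bullet> X"
    unfolding w sum.distrib sum_subtractf quad sum_distrib_left[symmetric]
    by (simp add: d_row inner_vec_def[of X])
  finally show ?thesis by simp
qed

section \<open>Fixed points of the argmax map\<close>

theorem theorem15:
  fixes X :: "real^'n^'n"
  assumes "X \<in> elliptope"
  shows "X \<in> T X \<longleftrightarrow> (\<exists>D. diagonal_matrix D \<and> X ** X = D ** X)"
proof
  assume "X \<in> T X"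
  then obtain c where c: "\<And>a. X *v (X $ a) = c a *\<^sub>R X $ a"
    using fixed_point_row_eigenvector by metis
  define D :: "real^'n^'n" where "D = (\<chi> i j. if i = j then c i else 0)"
  have D: "diagonal_matrix D" by (simp add: diagonal_matrix_def D_def)
  have "(X ** X) $ i $ j = (D ** X) $ i $ j" for i j
  proof -
    \<comment> \<open>By symmetry, row \<open>i\<close> of \<open>X\<^sup>2\<close> is \<open>X\<close> applied to row \<open>i\<close> of \<open>X\<close>.\<close>
    have "(X ** X) $ i $ j = (X *v (X $ i)) $ j"
      using symmetric_matrix_entry[OF elliptope_symmetric[OF assms], of _ j]
      by (simp add: matrix_matrix_mult_def matrix_vector_mult_def mult.commute)
    then show ?thesis
      by (simp add: c diagonal_matrix_mult_entry[OF D]) (simp add: D_def)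
  qed
  with D show "\<exists>D. diagonal_matrix D \<and> X ** X = D ** X"
    by (auto simp: vec_eq_iff)
next
  assume "\<exists>D. diagonal_matrix D \<and> X ** X = D ** X"
  with assms show "X \<in> T X"
    by (auto simp: mem_T_iff intro: diagonal_equation_imp_optimal)
qed

end
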